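(* Let $H$ be a graph with maximum degree less than $|V(H)|-1$. Then $fix_f(K_1\odot H)=fix_f(H)$.
   Context: All graphs are finite, simple and undirected. $K_1\odot H$ (the corona product of the one-vertex graph $K_1$ with $H$) is the graph obtained from $H$ by adding one new vertex adjacent to all vertices of $H$. Let $\Gamma=\Gamma(G)$ be the automorphism group of a graph $G$. For $u\in V(G)$, $O(u)$ is the $\Gamma$-orbit of $u$; for $x\in V(G)$, $\Gamma_x$ is the stabilizer of $x$ and $O_x(u)=\{\pi(u):\pi\in\Gamma_x\}$. Let $V_a(G)=\{(u,v): u\neq v,\ O(u)=O(v)\}$. For vertices $u,v$ let $F(u,v)=\{x\in V(G):O_x(u)\neq O_x(v)\}$. A function $g:V(G)\to[0,1]$ is a fixing function of $G$ if $\sum_{x\in F(u,v)}g(x)\ge 1$ for every $(u,v)\in V_a(G)$. Put $|g|=\sum_{x\in V(G)}g(x)$. The fractional fixing number $fix_f(G)$ is the minimum of $|g|$ over all fixing functions $g$ of $G$ (so it is $0$ if $G$ has trivial automorphism group). *)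

theory Defs
  imports "Graph_Theory.Pair_Digraph" "HOL-Combinatorics.Permutations"
    "HOL-Analysis.Function_Topology"
begin

text \<open>
  A finite simple undirected graph is a \<open>pair_graph\<close>: finite vertex set \<open>pverts\<close> and a
  symmetric irreflexive arc set \<open>parcs\<close>. Each edge is stored as two opposite arcs, so the
  degree of a vertex is its out-degree.
\<close>

definition max_degree :: "'a pair_pre_digraph \<Rightarrow> nat" where
  "max_degree G = Max (out_degree (with_proj G) ` pverts G)"

text \<open>\<open>None\<close> is the added vertex; the vertices of \<open>H\<close> are embedded by \<open>Some\<close>.\<close>

definition K1_corona :: "'a pair_pre_digraph \<Rightarrow> 'a option pair_pre_digraph" where
  "K1_corona H = \<lparr>
    pverts = insert None (Some ` pverts H),
    parcs = {(Some u, Some v) | u v. (u, v) \<in> parcs H}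
      \<union> {(None, Some v) | v. v \<in> pverts H}
      \<union> {(Some v, None) | v. v \<in> pverts H}\<rparr>"

lemma pair_graph_K1_corona:
  assumes "pair_graph H"
  shows "pair_graph (K1_corona H)"
proof -
  interpret pair_graph H by fact
  have fin: "finite (parcs (K1_corona H))"
  proof (rule finite_subset)
    show "parcs (K1_corona H) \<subseteq> pverts (K1_corona H) \<times> pverts (K1_corona H)"
      by (auto simp: K1_corona_def dest: in_arcsD1 in_arcsD2)
  qed (use pair_finite_verts in \<open>auto simp: K1_corona_def\<close>)
  show ?thesis
  proof unfold_locales
    show "symmetric (with_proj (K1_corona H))"
      by (auto simp: symmetric_def K1_corona_def intro!: symI dest: arcs_symmetric)
  qed (use fin pair_finite_verts in
      \<open>auto simp: K1_corona_def dest: in_arcsD1 in_arcsD2 no_loops'\<close>)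
qed

text \<open>
  Automorphisms are permutations of the vertex set, extended by the identity to the whole type.
\<close>

definition automorphisms :: "'a pair_pre_digraph \<Rightarrow> ('a \<Rightarrow> 'a) set" where
  "automorphisms G = {\<pi>. \<pi> permutes pverts G \<and>
    (\<forall>u\<in>pverts G. \<forall>v\<in>pverts G. (u, v) \<in> parcs G \<longleftrightarrow> (\<pi> u, \<pi> v) \<in> parcs G)}"

definition aut_orbit :: "'a pair_pre_digraph \<Rightarrow> 'a \<Rightarrow> 'a set" where
  "aut_orbit G u = {\<pi> u | \<pi>. \<pi> \<in> automorphisms G}"

definition aut_stabilizer :: "'a pair_pre_digraph \<Rightarrow> 'a \<Rightarrow> ('a \<Rightarrow> 'a) set" where
  "aut_stabilizer G x = {\<pi> \<in> automorphisms G. \<pi> x = x}"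

definition stab_orbit :: "'a pair_pre_digraph \<Rightarrow> 'a \<Rightarrow> 'a \<Rightarrow> 'a set" where
  "stab_orbit G x u = {\<pi> u | \<pi>. \<pi> \<in> aut_stabilizer G x}"

definition similar_pairs :: "'a pair_pre_digraph \<Rightarrow> ('a \<times> 'a) set" where
  "similar_pairs G = {(u, v). u \<in> pverts G \<and> v \<in> pverts G \<and> u \<noteq> v \<and> aut_orbit G u = aut_orbit G v}"

definition fixing_set :: "'a pair_pre_digraph \<Rightarrow> 'a \<Rightarrow> 'a \<Rightarrow> 'a set" where
  "fixing_set G u v = {x \<in> pverts G. stab_orbit G x u \<noteq> stab_orbit G x v}"

text \<open>The values of \<open>g\<close> outside the vertex set are irrelevant.\<close>

definition fixing_function :: "'a pair_pre_digraph \<Rightarrow> ('a \<Rightarrow> real) \<Rightarrow> bool" where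
  "fixing_function G g \<longleftrightarrow>
    (\<forall>x\<in>pverts G. 0 \<le> g x \<and> g x \<le> 1) \<and>
    (\<forall>(u, v)\<in>similar_pairs G. (\<Sum>x\<in>fixing_set G u v. g x) \<ge> 1)"

text \<open>
  For a finite graph this infimum is attained, i.e. it is a minimum; see \<open>fix_f_attained\<close>
  and \<open>fix_f_le\<close> below.
\<close>

definition fix_f :: "'a pair_pre_digraph \<Rightarrow> real" where
  "fix_f G = Inf {\<Sum>x\<in>pverts G. g x | g. fixing_function G g}"

lemma id_in_automorphisms: "id \<in> automorphisms G"
  by (auto simp: automorphisms_def permutes_id)

lemma fixing_function_one:
  assumes "finite (pverts G)"
  shows "fixing_function G (\<lambda>_. 1)"
proof -
  have "(\<Sum>x\<in>fixing_set G u v. 1::real) \<ge> 1" if "(u, v) \<in> similar_pairs G" for u v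
  proof -
    have uv: "u \<in> pverts G" "u \<noteq> v"
      using that by (auto simp: similar_pairs_def)
    have "v \<in> stab_orbit G u v"
      using id_in_automorphisms[of G] by (auto simp: stab_orbit_def aut_stabilizer_def intro!: exI[of _ id])
    moreover have "v \<notin> stab_orbit G u u"
      using uv by (auto simp: stab_orbit_def aut_stabilizer_def)
    ultimately have "u \<in> fixing_set G u v"
      using uv by (auto simp: fixing_set_def)
    moreover have "finite (fixing_set G u v)"
      using assms by (auto simp: fixing_set_def)
    ultimately have "card (fixing_set G u v) > 0"
      by (auto simp: card_gt_0_iff)
    then show ?thesis
      by simp
  qed
  then show ?thesis
    by (auto simp: fixing_function_def)
qed

lemma fix_f_le:
  assumes "fixing_function G g"
  shows "fix_f G \<le> (\<Sum>x\<in>pverts G. g x)"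
  unfolding fix_f_def
proof (rule cInf_lower)
  show "bdd_below {\<Sum>x\<in>pverts G. g x | g. fixing_function G g}"
    by (rule bdd_belowI[of _ 0]) (auto simp: fixing_function_def intro!: sum_nonneg)
qed (use assms in blast)

lemma fix_f_attained:
  fixes G :: "'a pair_pre_digraph"
  assumes fin: "finite (pverts G)"
  obtains g where "fixing_function G g" "fix_f G = (\<Sum>x\<in>pverts G. g x)"
proof -
  let ?V = "pverts G"
  define B where "B = (\<lambda>x. if x \<in> ?V then {0..1::real} else {0})"
  define C where "C = {g. \<forall>(u, v)\<in>similar_pairs G. (\<Sum>x\<in>fixing_set G u v. g x) \<ge> (1::real)}"
  have cont: "continuous_on UNIV (\<lambda>g::'a \<Rightarrow> real. \<Sum>x\<in>A. g x)" for A
    by (intro continuous_intros continuous_on_product_coordinates)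
  have "compactin (product_topology (\<lambda>_. euclidean) UNIV) (PiE UNIV B)"
    by (subst compactin_PiE) (auto simp: B_def)
  then have "compact (PiE UNIV B)"
    by (simp add: euclidean_product_topology)
  moreover have "closed C"
  proof -
    have "C = (\<Inter>(u, v)\<in>similar_pairs G. {g. (\<Sum>x\<in>fixing_set G u v. g x) \<ge> 1})"
      by (auto simp: C_def)
    moreover have "closed {g::'a \<Rightarrow> real. (\<Sum>x\<in>A. g x) \<ge> 1}" for A
      by (intro closed_Collect_le cont continuous_on_const)
    ultimately show ?thesis
      by (auto intro!: closed_INT)
  qed
  ultimately have cpt: "compact (PiE UNIV B \<inter> C)"
    by (rule compact_Int_closed)
  have ext: "(\<lambda>x. if x \<in> ?V then g x else 0) \<in> PiE UNIV B \<inter> C" if "fixing_function G g" for g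
  proof -
    have "(\<Sum>x\<in>fixing_set G u v. if x \<in> ?V then g x else 0) = (\<Sum>x\<in>fixing_set G u v. g x)" for u v
      by (rule sum.cong) (auto simp: fixing_set_def)
    with that show ?thesis
      by (auto simp: fixing_function_def B_def C_def)
  qed
  have "PiE UNIV B \<inter> C \<noteq> {}"
    using ext[OF fixing_function_one[OF fin]] by blast
  then obtain g where g: "g \<in> PiE UNIV B \<inter> C"
    and min: "\<And>h. h \<in> PiE UNIV B \<inter> C \<Longrightarrow> (\<Sum>x\<in>?V. g x) \<le> (\<Sum>x\<in>?V. h x)"
    using continuous_attains_inf[OF cpt _ continuous_on_subset[OF cont[of ?V] subset_UNIV]]
    by blast
  have "g x \<in> B x" for x
    using g by auto
  then have ff: "fixing_function G g"
    using g by (fastforce simp: fixing_function_def B_def C_def split: if_splits)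
  have "(\<Sum>x\<in>?V. g x) \<le> fix_f G"
    unfolding fix_f_def
  proof (rule cInf_greatest)
    fix r assume "r \<in> {\<Sum>x\<in>?V. g x | g. fixing_function G g}"
    then obtain h where h: "fixing_function G h" "r = (\<Sum>x\<in>?V. h x)"
      by blast
    have "(\<Sum>x\<in>?V. if x \<in> ?V then h x else 0) = r"
      using h(2) by (auto intro: sum.cong)
    with min[OF ext[OF h(1)]] show "(\<Sum>x\<in>?V. g x) \<le> r"
      by simp
  qed (use ff in blast)
  with fix_f_le[OF ff] ff show thesis
    using that by force
qed

end

theory Submission
  imports Defs
begin

text \<open>
  Write \<open>K\<close> for the corona. Its new vertex \<open>None\<close> is adjacent to everything else, whereas by the
  degree hypothesis every vertex of \<open>H\<close> has a non-neighbour in \<open>H\<close>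
  (\<open>ex_nonneighbour\<close>). Hence \<open>None\<close> is the only universal vertex of \<open>K\<close>, every automorphism fixes
  it, and restriction to \<open>H\<close> identifies the automorphism group of \<open>K\<close> with that of \<open>H\<close>
  (\<open>automorphisms_K1_corona\<close>).

  All orbits, and all orbits of stabilizers of vertices of \<open>H\<close>, are therefore the same in \<open>K\<close> as in
  \<open>H\<close>, so that the similar pairs coincide. The stabilizer of \<open>None\<close> is the whole group, so
  \<open>None\<close> separates no similar pair, and the fixing sets of similar pairs coincide as well. So a
  fixing function of \<open>K\<close> restricts to one of \<open>H\<close> of no larger weight, and a fixing function of
  \<open>H\<close> extended by the value \<open>0\<close> at \<open>None\<close> is one of \<open>K\<close> of the same weight.
\<close>

lemma pverts_K1_corona: "pverts (K1_corona H) = insert None (Some ` pverts H)"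
  by (simp add: K1_corona_def)

lemma arcs_K1_corona_simps [simp]:
  "(Some u, Some v) \<in> parcs (K1_corona H) \<longleftrightarrow> (u, v) \<in> parcs H"
  "(None, Some v) \<in> parcs (K1_corona H) \<longleftrightarrow> v \<in> pverts H"
  "(Some v, None) \<in> parcs (K1_corona H) \<longleftrightarrow> v \<in> pverts H"
  "(None, None) \<notin> parcs (K1_corona H)"
  by (auto simp: K1_corona_def)

text \<open>
  A vertex adjacent to all others would have degree at least \<open>|V(H)| - 1\<close>.
\<close>

lemma ex_nonneighbour:
  assumes "pair_graph H" "max_degree H < card (pverts H) - 1" "v \<in> pverts H"
  obtains w where "w \<in> pverts H" "w \<noteq> v" "(v, w) \<notin> parcs H"
proof -
  interpret pair_graph H by fact
  have "\<exists>w\<in>pverts H. w \<noteq> v \<and> (v, w) \<notin> parcs H"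
  proof (rule ccontr)
    assume "\<not> ?thesis"
    then have sub: "Pair v ` (pverts H - {v}) \<subseteq> out_arcs (with_proj H) v"
      by (auto simp: out_arcs_def)
    have "card (pverts H) - 1 = card (Pair v ` (pverts H - {v}))"
      using assms(3) by (subst card_image) (auto simp: inj_on_def)
    also have "\<dots> \<le> out_degree (with_proj H) v"
      unfolding out_degree_def
      by (rule card_mono[OF finite_subset[OF _ pair_finite_arcs] sub]) (auto simp: out_arcs_def)
    also have "\<dots> \<le> max_degree H"
      unfolding max_degree_def using assms(3) pair_finite_verts by (intro Max_ge) auto
    finally show False
      using assms(2) by simp
  qed
  then show thesis
    using that by blast
qed

lemma map_option_permutes_insert_None:
  assumes \<pi>: "\<pi> permutes V"
  shows "map_option \<pi> permutes insert None (Some ` V)"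
  unfolding permutes_def
proof (intro conjI allI impI)
  show "map_option \<pi> y = y" if "y \<notin> insert None (Some ` V)" for y
    using that permutes_not_in[OF \<pi>] by (cases y) auto
  show "\<exists>!x. map_option \<pi> x = y" for y
  proof (rule ex1I)
    show "map_option \<pi> (map_option (inv \<pi>) y) = y"
      by (cases y) (simp_all add: permutes_inverses[OF \<pi>])
    show "x = map_option (inv \<pi>) y" if "map_option \<pi> x = y" for x
      using that by (cases x) (auto simp: permutes_inverses[OF \<pi>])
  qed
qed

lemma permutes_fixing_None:
  assumes \<rho>: "\<rho> permutes insert None (Some ` V)" and None: "\<rho> None = None"
  obtains \<pi> where "\<pi> permutes V" "\<rho> = map_option \<pi>"
proof
  define \<pi> where "\<pi> = the \<circ> \<rho> \<circ> Some"
  have "\<rho> (Some x) \<noteq> None" for x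
    using permutes_inj[OF \<rho>] None by (metis injD option.distinct(1))
  then have Some: "\<rho> (Some x) = Some (\<pi> x)" for x
    by (simp add: \<pi>_def)
  show "\<rho> = map_option \<pi>"
  proof
    show "\<rho> y = map_option \<pi> y" for y
      using None Some by (cases y) auto
  qed
  show "\<pi> permutes V"
    unfolding permutes_def
  proof (intro conjI allI impI)
    show "\<pi> x = x" if "x \<notin> V" for x
      using permutes_not_in[OF \<rho>, of "Some x"] that Some[of x] by auto
    show "\<exists>!x. \<pi> x = y" for y
    proof (rule ex_ex1I)
      obtain z where "\<rho> z = Some y"
        using permutes_surj[OF \<rho>] by (metis surjD)
      then show "\<exists>x. \<pi> x = y"
        using None Some by (cases z) auto
      show "x = x'" if "\<pi> x = y" "\<pi> x' = y" for x x'
        using that injD[OF permutes_inj[OF \<rho>], of "Some x" "Some x'"] by (simp add: Some)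
    qed
  qed
qed

text \<open>
  An automorphism sends \<open>None\<close> to a vertex adjacent to all others, and no vertex of \<open>H\<close> is such.
\<close>

lemma automorphism_K1_corona_None:
  assumes nonadj: "\<And>v. v \<in> pverts H \<Longrightarrow> \<exists>w\<in>pverts H. w \<noteq> v \<and> (v, w) \<notin> parcs H"
    and \<rho>: "\<rho> \<in> automorphisms (K1_corona H)"
  shows "\<rho> None = None"
proof (cases "\<rho> None")
  case (Some v)
  have perm: "\<rho> permutes insert None (Some ` pverts H)"
    using \<rho> by (simp add: automorphisms_def pverts_K1_corona)
  have "v \<in> pverts H"
    using permutes_in_image[OF perm, of None] Some by auto
  then obtain w where w: "w \<in> pverts H" "w \<noteq> v" "(v, w) \<notin> parcs H"
    using nonadj by blast
  obtain y where y: "\<rho> y = Some w"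
    using permutes_surj[OF perm] by (metis surjD)
  moreover have "y \<in> insert None (Some ` pverts H)"
    using permutes_in_image[OF perm, of y] y w by simp
  ultimately obtain z where z: "y = Some z" "z \<in> pverts H"
    using Some w by auto
  have "(None, y) \<in> parcs (K1_corona H) \<longleftrightarrow> (\<rho> None, \<rho> y) \<in> parcs (K1_corona H)"
    using \<rho> z by (auto simp: automorphisms_def pverts_K1_corona)
  with z y w Some show ?thesis
    by simp
qed

lemma map_option_automorphism_K1_corona_iff:
  assumes "\<pi> permutes pverts H"
  shows "map_option \<pi> \<in> automorphisms (K1_corona H) \<longleftrightarrow> \<pi> \<in> automorphisms H"
  using assms
  by (simp add: automorphisms_def pverts_K1_corona permutes_in_image
      map_option_permutes_insert_None)

lemma automorphisms_K1_corona:
  assumes nonadj: "\<And>v. v \<in> pverts H \<Longrightarrow> \<exists>w\<in>pverts H. w \<noteq> v \<and> (v, w) \<notin> parcs H"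
  shows "automorphisms (K1_corona H) = map_option ` automorphisms H"
proof (intro equalityI subsetI)
  fix \<rho> assume \<rho>: "\<rho> \<in> automorphisms (K1_corona H)"
  then have "\<rho> permutes insert None (Some ` pverts H)"
    by (simp add: automorphisms_def pverts_K1_corona)
  then obtain \<pi> where "\<pi> permutes pverts H" "\<rho> = map_option \<pi>"
    using permutes_fixing_None automorphism_K1_corona_None[OF nonadj \<rho>] by metis
  with \<rho> show "\<rho> \<in> map_option ` automorphisms H"
    using map_option_automorphism_K1_corona_iff by blast
next
  fix \<rho> assume "\<rho> \<in> map_option ` automorphisms H"
  then obtain \<pi> where \<pi>: "\<pi> \<in> automorphisms H" "\<rho> = map_option \<pi>"
    by blast
  moreover from \<pi>(1) have "\<pi> permutes pverts H"
    by (simp add: automorphisms_def)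
  ultimately show "\<rho> \<in> automorphisms (K1_corona H)"
    using map_option_automorphism_K1_corona_iff by blast
qed

context
  fixes H :: "'a pair_pre_digraph"
  assumes aut: "automorphisms (K1_corona H) = map_option ` automorphisms H"
begin

lemma aut_orbit_K1_corona:
  "aut_orbit (K1_corona H) None = {None}"
  "aut_orbit (K1_corona H) (Some u) = Some ` aut_orbit H u"
  using id_in_automorphisms[of H]
  by (auto simp: aut_orbit_def aut Setcompr_eq_image image_image image_constant_conv)

lemma aut_stabilizer_K1_corona:
  "aut_stabilizer (K1_corona H) None = map_option ` automorphisms H"
  "aut_stabilizer (K1_corona H) (Some x) = map_option ` aut_stabilizer H x"
  by (auto simp: aut_stabilizer_def aut)

lemma stab_orbit_K1_corona:
  "stab_orbit (K1_corona H) None (Some u) = Some ` aut_orbit H u"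
  "stab_orbit (K1_corona H) (Some x) (Some u) = Some ` stab_orbit H x u"
  by (simp_all add: stab_orbit_def aut_orbit_def aut_stabilizer_K1_corona Setcompr_eq_image
      image_image)

lemma similar_pairs_K1_corona:
  "similar_pairs (K1_corona H) = map_prod Some Some ` similar_pairs H"
proof (intro equalityI subsetI)
  fix p assume "p \<in> similar_pairs (K1_corona H)"
  moreover obtain a b where "p = (a, b)"
    by (cases p)
  ultimately show "p \<in> map_prod Some Some ` similar_pairs H"
    by (cases a; cases b)
      (auto simp: similar_pairs_def pverts_K1_corona aut_orbit_K1_corona inj_image_eq_iff)
qed (auto simp: similar_pairs_def pverts_K1_corona aut_orbit_K1_corona)

text \<open>
  \<open>None\<close> is absent because its stabilizer orbits are the full orbits, which agree on a similar pair.
\<close>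

lemma fixing_set_K1_corona:
  assumes "(u, v) \<in> similar_pairs H"
  shows "fixing_set (K1_corona H) (Some u) (Some v) = Some ` fixing_set H u v"
  using assms
  by (auto simp: fixing_set_def similar_pairs_def pverts_K1_corona stab_orbit_K1_corona
      inj_image_eq_iff)

lemma fixing_function_K1_corona:
  "fixing_function (K1_corona H) g \<longleftrightarrow> 0 \<le> g None \<and> g None \<le> 1 \<and> fixing_function H (g \<circ> Some)"
proof -
  have "(\<Sum>x\<in>fixing_set (K1_corona H) (Some u) (Some v). g x) = (\<Sum>x\<in>fixing_set H u v. (g \<circ> Some) x)"
    if "(u, v) \<in> similar_pairs H" for u v
    by (simp add: fixing_set_K1_corona[OF that] sum.reindex)
  then show ?thesis
    by (fastforce simp: fixing_function_def similar_pairs_K1_corona pverts_K1_corona)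
qed

end

theorem theorem5p4:
  fixes H :: "'a pair_pre_digraph"
  assumes "pair_graph H"
    and "max_degree H < card (pverts H) - 1"
  shows "fix_f (K1_corona H) = fix_f H"
proof (rule antisym)
  have aut: "automorphisms (K1_corona H) = map_option ` automorphisms H"
    using ex_nonneighbour[OF assms] by (intro automorphisms_K1_corona) metis
  have fin: "finite (pverts H)"
  proof -
    interpret pair_graph H by fact
    show ?thesis by (rule pair_finite_verts)
  qed
  then have finK: "finite (pverts (K1_corona H))"
    by (simp add: pverts_K1_corona)
  have weight: "(\<Sum>x\<in>pverts (K1_corona H). g x) = g None + (\<Sum>x\<in>pverts H. (g \<circ> Some) x)"
    for g :: "'a option \<Rightarrow> real"
    using fin by (simp add: pverts_K1_corona sum.reindex)
  show "fix_f (K1_corona H) \<le> fix_f H"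
  proof -
    obtain h where h: "fixing_function H h" "fix_f H = (\<Sum>x\<in>pverts H. h x)"
      using fix_f_attained[OF fin] .
    have "case_option 0 h \<circ> Some = h"
      by (simp add: fun_eq_iff)
    with h have "fixing_function (K1_corona H) (case_option 0 h)"
      by (simp add: fixing_function_K1_corona[OF aut])
    from fix_f_le[OF this] show ?thesis
      using h by (simp add: weight)
  qed
  show "fix_f H \<le> fix_f (K1_corona H)"
  proof -
    obtain g where g: "fixing_function (K1_corona H) g"
        "fix_f (K1_corona H) = (\<Sum>x\<in>pverts (K1_corona H). g x)"
      using fix_f_attained[OF finK] .
    then have "0 \<le> g None" and "fixing_function H (g \<circ> Some)"
      by (auto simp: fixing_function_K1_corona[OF aut])
    with fix_f_le[of H "g \<circ> Some"] show ?thesis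
      using g(2) by (simp add: weight)
  qed
qed

end
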